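(* Let $n\ge 1$ be an integer, let $Y$ be a topological space with at least $n$ points, and let $X=C^n(Y\times I)$. Suppose $Y$ can be embedded as a subspace of a space $Y'$ which is homeomorphic to $Y$ and which admits a retraction $r\colon Y'\to Y$. If $Y'-Y$ has at least $n-1$ points, then $$\mathrm{TC}_X(C^n(Y)\times C^n(Y))\ge \mathrm{TC}(Y).$$
   Context: $I=[0,1]$. For a space $X$, $P(X)$ is the space of all continuous maps $\sigma\colon I\to X$ with the compact-open topology. $\mathrm{TC}(X)$ is the smallest integer $k$ such that $X\times X$ has an open cover $U_1,\dots,U_k$ for which there are continuous maps $s_i\colon U_i\to P(X)$ with $s_i(x,y)(0)=x$ and $s_i(x,y)(1)=y$ for all $(x,y)\in U_i$; if no such $k$ exists, $\mathrm{TC}(X)=\infty$. For $A\subseteq X\times X$, $P_X(A)\subseteq P(X)$ is the subspace of paths $\sigma$ with $(\sigma(0),\sigma(1))\in A$, and $\mathrm{TC}_X(A)$ is the smallest integer $k$ such that $A$ has a cover by sets $U_1,\dots,U_k$ open in $A$ for which there are continuous maps $s_i\colon U_i\to P_X(A)$ with $s_i(x,y)(0)=x$ and $s_i(x,y)(1)=y$ for all $(x,y)\in U_i$; if no such $k$ exists, $\mathrm{TC}_X(A)=\infty$. (Paths may leave the subspaces in which their endpoints lie.) For any space $Z$, $C^n(Z)=\{(z_1,\dots,z_n)\in Z^n : z_i\neq z_j\text{ for }i\ne j\}$ with the subspace topology from $Z^n$. $Y$ is identified with the subspace $Y\times\{0\}$ of $Y\times I$, and correspondingly $C^n(Y)$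 is viewed as a subspace of $C^n(Y\times I)$ via $(y_1,\dots,y_n)\mapsto((y_1,0),\dots,(y_n,0))$. A retraction $r\colon Y'\to Y$ is a continuous map restricting to the identity on the embedded copy of $Y$; the homeomorphism between $Y'$ and $Y$ is not required to be related to the embedding or to $r$. *)

theory Defs
  imports "HOL-Analysis.Analysis" "HOL-Library.Extended_Nat"
begin

text \<open>
  Spaces are values of type \<open>'a topology\<close>. A continuous map between spaces is represented by its
  extensional HOL function on the underlying set of the domain, so that equality of points of a
  mapping space is equality of maps.
\<close>

definition compact_open_topology ::
    "'a topology \<Rightarrow> 'b topology \<Rightarrow> ('a \<Rightarrow> 'b) topology" where
  "compact_open_topology A X =
     topology_generated_by
       {{f \<in> extensional (topspace A). continuous_map A X f \<and> f ` K \<subseteq> U} | K U.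
          compactin A K \<and> openin X U}"

lemma topspace_compact_open_topology:
  "topspace (compact_open_topology A X) = {f \<in> extensional (topspace A). continuous_map A X f}"
  (is "_ = ?P")
proof -
  let ?B = "{{f \<in> extensional (topspace A). continuous_map A X f \<and> f ` K \<subseteq> U} | K U.
          compactin A K \<and> openin X U}"
  have "compactin A {}" by simp
  then have "{f \<in> extensional (topspace A). continuous_map A X f \<and> f ` {} \<subseteq> topspace X} \<in> ?B"
    using openin_topspace by blast
  moreover have "{f \<in> extensional (topspace A). continuous_map A X f \<and> f ` {} \<subseteq> topspace X} = ?P"
    by simp
  ultimately have "?P \<in> ?B" by simp
  then have "?P \<subseteq> \<Union>?B" by (rule Union_upper)
  moreover have "\<Union>?B \<subseteq> ?P" by blast
  ultimately show ?thesis
    unfolding compact_open_topology_def topology_generated_by_topspace by (rule subset_antisym[rotated])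
qed

definition path_space :: "'a topology \<Rightarrow> (real \<Rightarrow> 'a) topology" where
  "path_space X = compact_open_topology (top_of_set {0..1}) X"

definition TC :: "'a topology \<Rightarrow> enat" where
  "TC X = Inf {enat k | k. \<exists>U s.
     (\<forall>i<k. openin (prod_topology X X) (U i)) \<and>
     (\<Union>i<k. U i) = topspace X \<times> topspace X \<and>
     (\<forall>i<k. continuous_map (subtopology (prod_topology X X) (U i)) (path_space X) (s i) \<and>
            (\<forall>(x, y) \<in> U i. s i (x, y) 0 = x \<and> s i (x, y) 1 = y))}"

definition path_space_rel :: "'a topology \<Rightarrow> ('a \<times> 'a) set \<Rightarrow> (real \<Rightarrow> 'a) topology" where
  "path_space_rel X A = subtopology (path_space X) {\<sigma>. (\<sigma> 0, \<sigma> 1) \<in> A}"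

text \<open>The relative invariant is meant for \<open>A \<subseteq> topspace X \<times> topspace X\<close>.\<close>

definition TC_rel :: "'a topology \<Rightarrow> ('a \<times> 'a) set \<Rightarrow> enat" where
  "TC_rel X A = Inf {enat k | k. \<exists>U s.
     (\<forall>i<k. openin (subtopology (prod_topology X X) A) (U i)) \<and>
     (\<Union>i<k. U i) = A \<and>
     (\<forall>i<k. continuous_map (subtopology (prod_topology X X) (U i)) (path_space_rel X A) (s i) \<and>
            (\<forall>(x, y) \<in> U i. s i (x, y) 0 = x \<and> s i (x, y) 1 = y))}"

text \<open>Points of the \<open>n\<close>-fold power are extensional functions on the index set \<open>{..<n}\<close>.\<close>

definition config_space :: "nat \<Rightarrow> 'a topology \<Rightarrow> (nat \<Rightarrow> 'a) topology" where
  "config_space n Z =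
     subtopology (product_topology (\<lambda>_. Z) {..<n}) {z. inj_on z {..<n}}"

definition cylinder :: "'a topology \<Rightarrow> ('a \<times> real) topology" where
  "cylinder Y = prod_topology Y (top_of_set {0..1})"

text \<open>The copy of \<open>C\<^sup>n(Y)\<close> inside \<open>C\<^sup>n(Y \<times> I)\<close> given by the identification of \<open>Y\<close> with \<open>Y \<times> {0}\<close>.\<close>

definition base_configs :: "nat \<Rightarrow> 'a topology \<Rightarrow> (nat \<Rightarrow> 'a \<times> real) set" where
  "base_configs n Y = (\<lambda>z. \<lambda>i\<in>{..<n}. (z i, 0)) ` topspace (config_space n Y)"

lemma base_configs_subset: "base_configs n Y \<subseteq> topspace (config_space n (cylinder Y))"
proof
  fix w assume "w \<in> base_configs n Y"
  then obtain z where z: "z \<in> {..<n} \<rightarrow>\<^sub>E topspace Y" "inj_on z {..<n}"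
    and w: "w = (\<lambda>i\<in>{..<n}. (z i, 0))"
    unfolding base_configs_def config_space_def by auto
  have "inj_on w {..<n}"
    using z(2) w by (simp add: inj_on_def)
  moreover have "w \<in> {..<n} \<rightarrow>\<^sub>E topspace Y \<times> {0..1}"
    using z(1) w by (simp add: PiE_iff)
  ultimately show "w \<in> topspace (config_space n (cylinder Y))"
    unfolding config_space_def cylinder_def by simp
qed

end

theory Submission
  imports Defs
begin

text \<open>
  Let \<open>h\<close> be a homeomorphism from \<open>Y'\<close> to \<open>Y\<close> and let \<open>b\<^sub>1, \<dots>, b\<^sub>n\<^sub>-\<^sub>1\<close> be distinct points of
  \<open>Y' - Y\<close>. Then \<open>\<phi> y = (h y, h b\<^sub>1, \<dots>, h b\<^sub>n\<^sub>-\<^sub>1)\<close> maps \<open>Y\<close> to \<open>C\<^sup>n(Y)\<close>, and projecting a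
  configuration in \<open>Y \<times> I\<close> to the \<open>Y\<close>-coordinate of its first point, followed by \<open>r \<circ> h\<^sup>-\<^sup>1\<close>, is a
  left inverse \<open>\<psi>\<close> of \<open>\<phi>\<close> that is defined on all of \<open>X\<close>. Hence motion planners pull back
  along \<open>\<phi>\<close> and push forward along \<open>\<psi>\<close>.
\<close>

text \<open>Pulling back the subbasic set of maps sending \<open>K\<close> into \<open>U\<close>
  gives the maps sending \<open>K\<close> into the preimage of \<open>U\<close> under
  \<open>g\<close>, which is again subbasic. The \<open>restrict\<close> keeps the composite
  extensional, as points of the mapping space must be.\<close>

lemma continuous_map_compact_open_postcompose:
  assumes "continuous_map X Z g"
  shows "continuous_map (compact_open_topology A X) (compact_open_topology A Z)
           (\<lambda>f. restrict (g \<circ> f) (topspace A))"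
    (is "continuous_map ?P _ ?G")
  unfolding compact_open_topology_def[of A Z]
proof (rule continuous_on_generated_topo)
  fix W
  assume "W \<in> {{f \<in> extensional (topspace A). continuous_map A Z f \<and> f ` K \<subseteq> U} | K U.
                 compactin A K \<and> openin Z U}"
  then obtain K U where K: "compactin A K" and U: "openin Z U"
    and W: "W = {f \<in> extensional (topspace A). continuous_map A Z f \<and> f ` K \<subseteq> U}"
    by blast
  define V where "V = {x \<in> topspace X. g x \<in> U}"
  have V: "openin X V"
    unfolding V_def using assms U by (rule openin_continuous_map_preimage)
  have KA: "K \<subseteq> topspace A"
    using K by (rule compactin_subset_topspace)
  have "?G -` W \<inter> topspace ?P
      = {f \<in> extensional (topspace A). continuous_map A X f \<and> f ` K \<subseteq> V}"
  proof (rule set_eqI)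
    fix f
    show "f \<in> ?G -` W \<inter> topspace ?P \<longleftrightarrow>
        f \<in> {f \<in> extensional (topspace A). continuous_map A X f \<and> f ` K \<subseteq> V}"
    proof (cases "f \<in> extensional (topspace A) \<and> continuous_map A X f")
      case True
      have "continuous_map A Z (g \<circ> f)"
        using True assms by (blast intro: continuous_map_compose)
      then have "continuous_map A Z (?G f)"
        by (rule continuous_map_eq) simp
      \<comment> \<open>The restriction is harmless here because \<open>K\<close> lies in
        \<open>topspace A\<close>.\<close>
      moreover have "?G f ` K \<subseteq> U \<longleftrightarrow> f ` K \<subseteq> V"
        using KA continuous_map_image_subset_topspace[of A X f] True
        by (auto simp: V_def subset_iff)
      ultimately show ?thesis
        using True by (simp add: W topspace_compact_open_topology)
    next
      case False
      then show ?thesis by (auto simp: topspace_compact_open_topology)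
    qed
  qed
  also have "openin ?P \<dots>"
    unfolding compact_open_topology_def using K V
    by (blast intro: topology_generated_by_Basis)
  finally show "openin ?P (?G -` W \<inter> topspace ?P)" .
next
  have "continuous_map A Z (restrict (g \<circ> f) (topspace A))" if "continuous_map A X f" for f
    by (rule continuous_map_eq[OF continuous_map_compose[OF that assms]]) simp
  then have "?G ` topspace ?P \<subseteq> topspace (compact_open_topology A Z)"
    by (auto simp: topspace_compact_open_topology)
  then show "?G ` topspace ?P
      \<subseteq> \<Union> {{f \<in> extensional (topspace A). continuous_map A Z f \<and> f ` K \<subseteq> U} | K U.
              compactin A K \<and> openin Z U}"
    unfolding compact_open_topology_def[of A Z] topology_generated_by_topspace .
qed

text \<open>A planner \<open>s i\<close> on \<open>U i\<close> yields the planner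
  \<open>\<psi> \<circ> s i \<circ> \<Phi>\<close> on the preimage of \<open>U i\<close>. Paths in
  \<open>X\<close> between endpoints given by \<open>A\<close> may wander anywhere in
  \<open>X\<close>, so \<open>\<psi>\<close> has to be defined on all of \<open>X\<close>.\<close>

lemma TC_le_TC_rel:
  assumes \<phi>: "continuous_map Y X \<phi>" and \<psi>: "continuous_map X Y \<psi>"
    and left_inverse: "\<And>y. y \<in> topspace Y \<Longrightarrow> \<psi> (\<phi> y) = y"
    and A: "\<And>x y. x \<in> topspace Y \<Longrightarrow> y \<in> topspace Y \<Longrightarrow> (\<phi> x, \<phi> y) \<in> A"
  shows "TC Y \<le> TC_rel X A"
  unfolding TC_def TC_rel_def
\<comment> \<open>It suffices that every number of planners that works for \<open>A\<close> also
  works for \<open>Y\<close>; if none works for \<open>A\<close>, the right-hand infimum is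
  infinite.\<close>
proof (rule Inf_superset_mono, rule subsetI)
  fix m
  assume "m \<in> {enat k | k. \<exists>U s.
     (\<forall>i<k. openin (subtopology (prod_topology X X) A) (U i)) \<and>
     (\<Union>i<k. U i) = A \<and>
     (\<forall>i<k. continuous_map (subtopology (prod_topology X X) (U i)) (path_space_rel X A) (s i) \<and>
            (\<forall>(x, y) \<in> U i. s i (x, y) 0 = x \<and> s i (x, y) 1 = y))}"
  then obtain k U s where m: "m = enat k"
    and U: "\<forall>i<k. openin (subtopology (prod_topology X X) A) (U i)"
    and UA: "(\<Union>i<k. U i) = A"
    and s: "\<forall>i<k. continuous_map (subtopology (prod_topology X X) (U i)) (path_space_rel X A) (s i) \<and>
              (\<forall>(x, y) \<in> U i. s i (x, y) 0 = x \<and> s i (x, y) 1 = y)"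
    by blast
  define \<Phi> where "\<Phi> = map_prod \<phi> \<phi>"
  have \<Phi>: "continuous_map (prod_topology Y Y) (prod_topology X X) \<Phi>"
    unfolding \<Phi>_def map_prod_def using \<phi> by (intro continuous_map_prod_top[THEN iffD2]) simp
  define V where "V i = {p \<in> topspace (prod_topology Y Y). \<Phi> p \<in> U i}" for i
  define t where "t i p = restrict (\<psi> \<circ> s i (\<Phi> p)) {0..1::real}" for i p
  \<comment> \<open>Each \<open>U i\<close> is open only relative to \<open>A\<close>, so openness
    of \<open>V i\<close> needs continuity of \<open>\<Phi>\<close> into the subspace
    \<open>A\<close>.\<close>
  have \<Phi>A: "continuous_map (prod_topology Y Y) (subtopology (prod_topology X X) A) \<Phi>"
    using \<Phi> A by (auto simp: continuous_map_in_subtopology \<Phi>_def)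
  have "openin (prod_topology Y Y) (V i)" if "i < k" for i
    unfolding V_def using \<Phi>A U that by (blast intro: openin_continuous_map_preimage)
  moreover have "(\<Union>i<k. V i) = topspace Y \<times> topspace Y"
    using A UA by (auto simp: V_def \<Phi>_def)
  moreover have "continuous_map (subtopology (prod_topology Y Y) (V i)) (path_space Y) (t i)"
    if "i < k" for i
  proof -
    have "continuous_map (subtopology (prod_topology Y Y) (V i))
            (subtopology (prod_topology X X) (U i)) \<Phi>"
      using \<Phi> by (auto simp: continuous_map_in_subtopology continuous_map_from_subtopology V_def)
    moreover have "continuous_map (subtopology (prod_topology X X) (U i)) (path_space X) (s i)"
      using s that by (simp add: path_space_rel_def continuous_map_in_subtopology)
    moreover have "continuous_map (path_space X) (path_space Y) (\<lambda>f. restrict (\<psi> \<circ> f) {0..1})"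
      using continuous_map_compact_open_postcompose[OF \<psi>, of "top_of_set {0..1::real}"]
      by (simp add: path_space_def)
    ultimately have "continuous_map (subtopology (prod_topology Y Y) (V i)) (path_space Y)
        ((\<lambda>f. restrict (\<psi> \<circ> f) {0..1}) \<circ> (s i \<circ> \<Phi>))"
      by (blast intro: continuous_map_compose)
    then show ?thesis by (simp add: t_def[abs_def] comp_def)
  qed
  \<comment> \<open>The path \<open>s i (\<Phi> (x, y))\<close> runs from \<open>\<phi> x\<close> to
    \<open>\<phi> y\<close>, and \<open>\<psi>\<close> sends these endpoints back to
    \<open>x\<close> and \<open>y\<close>.\<close>
  moreover have "t i (x, y) 0 = x \<and> t i (x, y) 1 = y" if "i < k" "(x, y) \<in> V i" for i x y
    using that s left_inverse by (fastforce simp: V_def \<Phi>_def t_def)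
  ultimately have "\<exists>U s.
     (\<forall>i<k. openin (prod_topology Y Y) (U i)) \<and>
     (\<Union>i<k. U i) = topspace Y \<times> topspace Y \<and>
     (\<forall>i<k. continuous_map (subtopology (prod_topology Y Y) (U i)) (path_space Y) (s i) \<and>
            (\<forall>(x, y) \<in> U i. s i (x, y) 0 = x \<and> s i (x, y) 1 = y))"
    by (intro exI[of _ V] exI[of _ t]) auto
  then show "m \<in> {enat k | k. \<exists>U s.
     (\<forall>i<k. openin (prod_topology Y Y) (U i)) \<and>
     (\<Union>i<k. U i) = topspace Y \<times> topspace Y \<and>
     (\<forall>i<k. continuous_map (subtopology (prod_topology Y Y) (U i)) (path_space Y) (s i) \<and>
            (\<forall>(x, y) \<in> U i. s i (x, y) 0 = x \<and> s i (x, y) 1 = y))}"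
    using m by blast
qed

theorem theorem3p7:
  fixes n :: nat and Y :: "'a topology" and Y' :: "'b topology"
    and e :: "'a \<Rightarrow> 'b" and r :: "'b \<Rightarrow> 'a"
  assumes "n \<ge> 1"
    and "\<exists>S \<subseteq> topspace Y. finite S \<and> card S = n"
    and "embedding_map Y Y' e"
    and "Y' homeomorphic_space Y"
    and "retraction_maps Y' Y r e"
    and "\<exists>S \<subseteq> topspace Y' - e ` topspace Y. finite S \<and> card S = n - 1"
  shows "TC_rel (config_space n (cylinder Y)) (base_configs n Y \<times> base_configs n Y) \<ge> TC Y"
proof -
  obtain h g where hg: "homeomorphic_maps Y' Y h g"
    using assms(4) unfolding homeomorphic_space_def by blast
  then have h: "continuous_map Y' Y h" and g: "continuous_map Y Y' g"
    and gh: "\<And>x. x \<in> topspace Y' \<Longrightarrow> g (h x) = x"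
    by (auto simp: homeomorphic_maps_def)
  have r: "continuous_map Y' Y r" and e: "continuous_map Y Y' e"
    and re: "\<And>y. y \<in> topspace Y \<Longrightarrow> r (e y) = y"
    using assms(5) by (auto simp: retraction_maps_def)
  \<comment> \<open>Writing \<open>n - 1\<close> as \<open>card {1..<n}\<close> lets the extra
    points be indexed from 1, which leaves index 0 for the moving point.\<close>
  obtain S where S: "S \<subseteq> topspace Y' - e ` topspace Y" "finite S" "card S = card {1..<n}"
    using assms(6) by auto
  then obtain b where b: "bij_betw b {1..<n} S"
    using finite_same_card_bij[of "{1..<n}" S] by auto
  define c where "c y j = (if j = 0 then e y else b j)" for y j
  have bS: "b j \<in> S" if "1 \<le> j" "j < n" for j
    using b that by (auto simp: bij_betw_def)
  have eY: "e y \<in> topspace Y'" if "y \<in> topspace Y" for y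
    using e that by (auto simp: continuous_map_def)
  have hY: "h y \<in> topspace Y" if "y \<in> topspace Y'" for y
    using h that by (auto simp: continuous_map_def)
  have c_in: "c y j \<in> topspace Y'" if "y \<in> topspace Y" "j < n" for y j
    using bS[of j] eY[of y] S(1) that by (cases "j = 0") (auto simp: c_def)
  have c_inj: "inj_on (c y) {..<n}" if y: "y \<in> topspace Y" for y
  proof (rule inj_onI)
    fix i j
    assume ij: "i \<in> {..<n}" "j \<in> {..<n}" "c y i = c y j"
    \<comment> \<open>The fixed points lie outside the embedded copy of \<open>Y\<close>, so the
      moving point \<open>e y\<close> never collides with them.\<close>
    have "b l \<noteq> e y" if "1 \<le> l" "l < n" for l
      using bS[OF that] S(1) y by blast
    then show "i = j"
      using ij inj_onD[OF bij_betw_imp_inj_on[OF b], of i j]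
      by (cases "i = 0"; cases "j = 0") (auto simp: c_def dest: sym)
  qed
  define \<phi> where "\<phi> y = (\<lambda>j\<in>{..<n}. (h (c y j), 0::real))" for y
  have \<phi>_base: "\<phi> y \<in> base_configs n Y" if y: "y \<in> topspace Y" for y
  proof -
    let ?z = "\<lambda>j\<in>{..<n}. h (c y j)"
    have "inj_on ?z {..<n}"
    proof (rule inj_onI)
      fix i j
      assume ij: "i \<in> {..<n}" "j \<in> {..<n}" "?z i = ?z j"
      then have "h (c y i) = h (c y j)" by simp
      \<comment> \<open>\<open>h\<close> is injective on \<open>Y'\<close> because \<open>g\<close>
        inverts it there.\<close>
      then have "c y i = c y j" using ij c_in[OF y] by (metis gh lessThan_iff)
      then show "i = j" using ij c_inj[OF y] by (simp add: inj_on_eq_iff)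
    qed
    then have "?z \<in> topspace (config_space n Y)"
      using c_in[OF y] hY by (auto simp: config_space_def)
    moreover have "\<phi> y = (\<lambda>j\<in>{..<n}. (?z j, 0))"
      by (auto simp: \<phi>_def)
    ultimately show ?thesis
      unfolding base_configs_def by blast
  qed
  \<comment> \<open>Coordinate 0 is \<open>e\<close>; all others are constant in
    \<open>y\<close>.\<close>
  have "continuous_map Y Y' (\<lambda>y. c y j)" if "j < n" for j
    using e bS[of j] S(1) that by (cases "j = 0") (auto simp: c_def)
  then have "continuous_map Y (cylinder Y) (\<lambda>y. (h (c y j), 0))" if "j < n" for j
    using that continuous_map_compose[OF _ h, unfolded comp_def]
    by (auto simp: cylinder_def continuous_map_pairwise comp_def)
  then have "continuous_map Y (product_topology (\<lambda>_. cylinder Y) {..<n}) \<phi>"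
    by (auto simp: continuous_map_componentwise \<phi>_def)
  then have \<phi>: "continuous_map Y (config_space n (cylinder Y)) \<phi>"
    using \<phi>_base base_configs_subset[of n Y]
    by (fastforce simp: config_space_def continuous_map_in_subtopology)
  \<comment> \<open>Index 0 exists since \<open>n \<ge> 1\<close>, and \<open>fst\<close> forgets
    the height, so configurations off the base are covered too. Then \<open>g\<close> undoes
    \<open>h\<close> and \<open>r\<close> undoes \<open>e\<close>.\<close>
  define \<psi> where "\<psi> = r \<circ> (g \<circ> (fst \<circ> (\<lambda>z :: nat \<Rightarrow> 'a \<times> real. z 0)))"
  have "continuous_map (config_space n (cylinder Y)) (cylinder Y) (\<lambda>z. z 0)"
    unfolding config_space_def using assms(1)
    by (intro continuous_map_from_subtopology continuous_map_product_projection) auto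
  moreover have "continuous_map (cylinder Y) Y fst"
    unfolding cylinder_def by (rule continuous_map_fst)
  ultimately have \<psi>: "continuous_map (config_space n (cylinder Y)) Y \<psi>"
    unfolding \<psi>_def using r g by (blast intro: continuous_map_compose)
  have "\<psi> (\<phi> y) = y" if "y \<in> topspace Y" for y
    using that assms(1) by (simp add: \<psi>_def \<phi>_def c_def gh eY re)
  then show ?thesis
    using \<phi>_base by (intro TC_le_TC_rel[OF \<phi> \<psi>]) auto
qed

end
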